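(* Let $X$ and $Y$ be mm-spaces and let $S$ be a closed subset of $X\times Y$. Then $$\operatorname{dis} S = 2\,(d^S_\infty)_{\mathrm{H}}\bigl(\mathrm{Lip}_1(X)\circ \mathrm{pr}_1,\ \mathrm{Lip}_1(Y)\circ \mathrm{pr}_2\bigr).$$
   Context: An mm-space is a triple $(X,d_X,\mu_X)$ with $(X,d_X)$ a complete separable metric space and $\mu_X$ a Borel probability measure on $X$ with $\operatorname{supp}\mu_X=X$. $\mathrm{Lip}_1(X)$ is the set of 1-Lipschitz functions $X\to\mathbb{R}$, $\mathrm{pr}_1,\mathrm{pr}_2$ are the projections of $X\times Y$ onto $X$ and $Y$, and $F\circ\varphi:=\{f\circ\varphi\mid f\in F\}$. The distortion of $S\subset X\times Y$ is $$\operatorname{dis} S:=\sup\{|d_X(x,x')-d_Y(y,y')|\ :\ (x,y),(x',y')\in S\}\in[0,+\infty]$$ (with $\operatorname{dis}\emptyset=0$). For real-valued functions $f,g$ on $X\times Y$, $d^S_\infty(f,g):=\sup_{s\in S}|f(s)-g(s)|$ (with $d^{\emptyset}_\infty\equiv 0$), an extended pseudo-distance, and $(d^S_\infty)_{\mathrm{H}}$ is its Hausdorff distance: $(d^S_\infty)_{\mathrm{H}}(A,B)=\max\{\sup_{a\in A}\inf_{b\in B}d^S_\infty(a,b),\ \sup_{b\in B}\inf_{a\in A}d^S_\infty(a,b)\}$, with values in $[0,+\infty]$. *)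

theory Defs
  imports "HOL-Analysis.Analysis" "HOL-Probability.Probability_Measure"
begin

text \<open>All distances take values in type ennreal, i.e. in the extended half-line from 0 to
  infinity. There the supremum of the empty set is 0, which gives the conventions that the
  distortion of the empty set and the pseudo-distance over the empty set vanish.\<close>

definition measure_support :: "'a::topological_space measure \<Rightarrow> 'a set" where
  "measure_support M = {x. \<forall>U. open U \<and> x \<in> U \<longrightarrow> 0 < emeasure M U}"

text \<open>The underlying complete separable metric space is a type of class polish_space (in
  HOL-Analysis this class extends metric_space, so dist is a fixed complete metric).\<close>

locale mm_space = prob_space M for M :: "'a::polish_space measure" +
  assumes sets_eq_borel: "sets M = sets borel"
    and full_support: "measure_support M = UNIV"

definition Lip1 :: "('a::metric_space \<Rightarrow> real) set" where
  "Lip1 = {f. 1-lipschitz_on UNIV f}"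

definition comp_set :: "('a \<Rightarrow> 'b) set \<Rightarrow> ('c \<Rightarrow> 'a) \<Rightarrow> ('c \<Rightarrow> 'b) set" where
  "comp_set F \<phi> = {f \<circ> \<phi> | f. f \<in> F}"

definition distortion :: "('a::metric_space \<times> 'b::metric_space) set \<Rightarrow> ennreal" where
  "distortion S = (SUP ((x, y), (x', y')) \<in> S \<times> S. ennreal \<bar>dist x x' - dist y y'\<bar>)"

definition sup_dist_on :: "'c set \<Rightarrow> ('c \<Rightarrow> real) \<Rightarrow> ('c \<Rightarrow> real) \<Rightarrow> ennreal" where
  "sup_dist_on S f g = (SUP s\<in>S. ennreal \<bar>f s - g s\<bar>)"

definition hausdorff_dist :: "('a \<Rightarrow> 'a \<Rightarrow> ennreal) \<Rightarrow> 'a set \<Rightarrow> 'a set \<Rightarrow> ennreal" where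
  "hausdorff_dist d A B = max (SUP a\<in>A. INF b\<in>B. d a b) (SUP b\<in>B. INF a\<in>A. d a b)"

end

theory Submission
  imports Defs
begin

text \<open>For the upper bound, a 1-Lipschitz function \<open>f\<close> on \<open>X\<close> is carried along \<open>S\<close> to the
  McShane extension \<open>y \<mapsto> inf {f x' + d y y' | (x', y') \<in> S}\<close>; on \<open>S\<close> this lies between \<open>f - dis S\<close>
  and \<open>f\<close>, so shifting it by half of \<open>dis S\<close> gives a function within \<open>dis S / 2\<close> of \<open>f\<close>.
  For the lower bound, compare the distance function from a point \<open>x\<close> with an arbitrary
  1-Lipschitz function on \<open>Y\<close> at two points of \<open>S\<close>.\<close>

lemma Lip1_iff: "f \<in> Lip1 \<longleftrightarrow> (\<forall>x y. f x - f y \<le> dist x y)"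
proof -
  have "\<bar>f x - f y\<bar> \<le> dist x y" if "\<forall>x y. f x - f y \<le> dist x y" for x y
    using that[rule_format, of x y] that[rule_format, of y x] by (simp add: dist_commute)
  then show ?thesis
    by (auto simp: Lip1_def lipschitz_on_def dist_real_def abs_le_iff)
qed

lemma dist_in_Lip1: "dist x \<in> Lip1"
  unfolding Lip1_iff by (metis dist_triangle diff_le_eq add.commute dist_commute)

lemma Lip1_transport:
  fixes S :: "('a::metric_space \<times> 'b::metric_space) set"
  assumes f: "f \<in> Lip1"
    and S: "\<And>x y x' y'. (x, y) \<in> S \<Longrightarrow> (x', y') \<in> S \<Longrightarrow> dist x x' \<le> dist y y' + 2 * r"
  shows "\<exists>g\<in>Lip1. \<forall>(x, y)\<in>S. \<bar>f x - g y\<bar> \<le> r"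
\<comment> \<open>The real infimum over the empty set carries no information, so empty
  \<open>S\<close> is split off; any member of \<open>Lip1\<close> serves there.\<close>
proof (cases "S = {}")
  case True
  then show ?thesis using dist_in_Lip1 by blast
next
  case False
  define F where "F y p = f (fst p) + dist y (snd p)" for y :: 'b and p
  define g where "g y = (INF p\<in>S. F y p)" for y
  \<comment> \<open>The free point \<open>z\<close> gives two uses: in general it makes the infimum
    at \<open>z\<close> finite, and \<open>z = y\<close> yields \<open>f x - 2 * r \<le> g y\<close>
    on \<open>S\<close>.\<close>
  have lower: "f x - 2 * r - dist y z \<le> F z p" if "(x, y) \<in> S" "p \<in> S" for x y z p
  proof -
    obtain x' y' where p: "p = (x', y')" by fastforce
    have "f x - f x' \<le> dist x x'" using f by (simp add: Lip1_iff)
    also have "\<dots> \<le> dist y y' + 2 * r" using S that p by blast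
    also have "dist y y' \<le> dist y z + dist z y'" by (rule dist_triangle)
    finally show ?thesis by (simp add: F_def p)
  qed
  have bdd: "bdd_below (F z ` S)" for z
    using lower False by (fastforce simp: bdd_below_def)
  \<comment> \<open>Each \<open>F _ p\<close> is 1-Lipschitz in its first argument, and this passes
    to the infimum.\<close>
  have "g y \<le> g z + dist y z" for y z
  proof -
    have "g y - dist y z \<le> F z p" if "p \<in> S" for p
    proof -
      have "g y \<le> F y p" unfolding g_def by (rule cINF_lower[OF bdd that])
      also have "\<dots> \<le> F z p + dist y z"
        using dist_triangle[of y "snd p" z] by (simp add: F_def)
      finally show ?thesis by simp
    qed
    then have "g y - dist y z \<le> g z"
      unfolding g_def[of z] by (intro cINF_greatest False)
    then show ?thesis by simp
  qed
  then have "(\<lambda>y. g y + r) \<in> Lip1" by (simp add: Lip1_iff algebra_simps)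
  moreover have "\<bar>f x - (g y + r)\<bar> \<le> r" if "(x, y) \<in> S" for x y
  proof -
    \<comment> \<open>The point \<open>(x, y)\<close> itself competes in the infimum, and there
      \<open>F\<close> equals \<open>f x\<close>.\<close>
    have "g y \<le> F y (x, y)" unfolding g_def by (rule cINF_lower[OF bdd that])
    moreover have "f x - 2 * r \<le> g y"
      unfolding g_def using lower[OF that, of _ y] by (intro cINF_greatest False) auto
    ultimately show ?thesis by (simp add: F_def abs_le_iff)
  qed
  ultimately show ?thesis by (intro bexI[of _ "\<lambda>y. g y + r"]) auto
qed

lemma distortion_le_iff:
  assumes "0 \<le> r"
  shows "distortion S \<le> ennreal r \<longleftrightarrow>
    (\<forall>(x, y)\<in>S. \<forall>(x', y')\<in>S. \<bar>dist x x' - dist y y'\<bar> \<le> r)"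
  using assms by (fastforce simp: distortion_def SUP_le_iff)

lemma sup_dist_on_le_iff:
  assumes "0 \<le> r"
  shows "sup_dist_on S f g \<le> ennreal r \<longleftrightarrow> (\<forall>s\<in>S. \<bar>f s - g s\<bar> \<le> r)"
  using assms by (auto simp: sup_dist_on_def SUP_le_iff)

lemma comp_set_eq_image: "comp_set F h = (\<lambda>f. f \<circ> h) ` F"
  by (auto simp: comp_set_def)

lemma sup_dist_on_converse:
  "sup_dist_on (S\<inverse>) (g \<circ> fst) (f \<circ> snd) = sup_dist_on S (f \<circ> fst) (g \<circ> snd)"
proof -
  have "S\<inverse> = prod.swap ` S" by force
  then show ?thesis
    by (simp add: sup_dist_on_def image_image abs_minus_commute)
qed

lemma distortion_converse_le: "distortion (S\<inverse>) \<le> distortion S"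
  unfolding distortion_def
  by (rule SUP_mono) (force simp: abs_minus_commute)

lemma distortion_converse: "distortion (S\<inverse>) = distortion S"
  using distortion_converse_le[of S] distortion_converse_le[of "S\<inverse>"] by simp

text \<open>One of the two one-sided terms of the Hausdorff distance. The other is the same
  expression for the converse relation, so each estimate needs proof in one direction only.\<close>

definition directed_Lip1_dist :: "('a::metric_space \<times> 'b::metric_space) set \<Rightarrow> ennreal" where
  "directed_Lip1_dist S =
    (SUP f\<in>Lip1. INF g\<in>Lip1. sup_dist_on S (f \<circ> fst) (g \<circ> snd))"

lemma hausdorff_dist_eq_directed:
  "hausdorff_dist (sup_dist_on S) (comp_set Lip1 fst) (comp_set Lip1 snd) =
    max (directed_Lip1_dist S) (directed_Lip1_dist (S\<inverse>))"
  by (simp add: hausdorff_dist_def directed_Lip1_dist_def comp_set_eq_image image_image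
      sup_dist_on_converse)

lemma directed_Lip1_dist_le: "2 * directed_Lip1_dist S \<le> distortion S"
\<comment> \<open>Infinite distortion makes the bound trivial; otherwise it is a real
  \<open>D\<close> and can be halved.\<close>
proof (cases "distortion S")
  case (real D)
  define r where "r = D / 2"
  have r: "0 \<le> r" "D = 2 * r" using real by (auto simp: r_def)
  have S: "dist x x' \<le> dist y y' + 2 * r" if "(x, y) \<in> S" "(x', y') \<in> S" for x y x' y'
    using distortion_le_iff[of D S] real that r by fastforce
  have "(INF g\<in>Lip1. sup_dist_on S (f \<circ> fst) (g \<circ> snd)) \<le> ennreal r" if f: "f \<in> Lip1" for f
  proof -
    obtain g where "g \<in> Lip1" "\<forall>(x, y)\<in>S. \<bar>f x - g y\<bar> \<le> r"
      using Lip1_transport[OF f S] by blast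
    then show ?thesis
      using r by (intro INF_lower2[of g]) (auto simp: sup_dist_on_le_iff)
  qed
  then have "directed_Lip1_dist S \<le> ennreal r"
    unfolding directed_Lip1_dist_def by (rule SUP_least)
  then have "2 * directed_Lip1_dist S \<le> 2 * ennreal r" by (rule mult_left_mono) simp
  also have "\<dots> = distortion S" using r real by (simp add: ennreal_mult)
  finally show ?thesis .
qed simp

text \<open>\<open>dist x\<close> rises from 0 at \<open>x\<close> to \<open>dist x x'\<close> at
  \<open>x'\<close>, whereas \<open>g\<close> gains at most \<open>dist y y'\<close> from
  \<open>y\<close> to \<open>y'\<close>. The errors at the two points of \<open>S\<close> thus add
  up to at least the difference, and one of them is at least half of it.\<close>

lemma dist_diff_le_sup_dist_on:
  assumes S: "(x, y) \<in> S" "(x', y') \<in> S" and g: "g \<in> Lip1"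
  shows "ennreal ((dist x x' - dist y y') / 2) \<le> sup_dist_on S (dist x \<circ> fst) (g \<circ> snd)"
proof (cases "sup_dist_on S (dist x \<circ> fst) (g \<circ> snd)")
  case (real e)
  then have e: "\<forall>s\<in>S. \<bar>dist x (fst s) - g (snd s)\<bar> \<le> e"
    using sup_dist_on_le_iff[of e S "dist x \<circ> fst" "g \<circ> snd"] by simp
  have "g y' - g y \<le> dist y y'" using g[unfolded Lip1_iff, rule_format, of y' y] by (simp add: dist_commute)
  moreover have "\<bar>g y\<bar> \<le> e" "\<bar>dist x x' - g y'\<bar> \<le> e" using e S by force+
  ultimately show ?thesis using real by (simp add: ennreal_leI)
qed simp

text \<open>No absolute value appears: \<open>ennreal\<close> sends a negative difference to 0, so
  this handles one sign only.\<close>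

lemma dist_diff_le_directed:
  assumes "(x, y) \<in> S" "(x', y') \<in> S"
  shows "ennreal (dist x x' - dist y y') \<le> 2 * directed_Lip1_dist S"
proof -
  have "ennreal ((dist x x' - dist y y') / 2) \<le> directed_Lip1_dist S"
    unfolding directed_Lip1_dist_def
    by (intro SUP_upper2[of "dist x"] dist_in_Lip1 INF_greatest dist_diff_le_sup_dist_on assms)
  then have "2 * ennreal ((dist x x' - dist y y') / 2) \<le> 2 * directed_Lip1_dist S"
    by (rule mult_left_mono) simp
  also have "2 * ennreal ((dist x x' - dist y y') / 2) = ennreal (2 * ((dist x x' - dist y y') / 2))"
    by (simp only: ennreal_mult' ennreal_numeral zero_le_numeral)
  also have "2 * ((dist x x' - dist y y') / 2) = dist x x' - dist y y'" by simp
  finally show ?thesis .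
qed

theorem lemma1p2:
  fixes \<mu>X :: "'a::polish_space measure"
    and \<mu>Y :: "'b::polish_space measure"
    and S :: "('a \<times> 'b) set"
  assumes "mm_space \<mu>X"
    and "mm_space \<mu>Y"
    and "closed S"
  shows "distortion S =
    2 * hausdorff_dist (sup_dist_on S) (comp_set Lip1 fst) (comp_set Lip1 snd)"
proof -
  let ?m = "max (directed_Lip1_dist S) (directed_Lip1_dist (S\<inverse>))"
  have "2 * ?m \<le> distortion S"
    using directed_Lip1_dist_le[of S] directed_Lip1_dist_le[of "S\<inverse>"]
    by (simp add: max_def distortion_converse)
  moreover have "distortion S \<le> 2 * ?m"
  proof -
    have "ennreal \<bar>dist x x' - dist y y'\<bar> \<le> 2 * ?m"
      if S: "(x, y) \<in> S" "(x', y') \<in> S" for x y x' y'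
    proof -
      have mono: "2 * directed_Lip1_dist S \<le> 2 * ?m" "2 * directed_Lip1_dist (S\<inverse>) \<le> 2 * ?m"
        by (auto intro: mult_left_mono)
      have "ennreal (dist x x' - dist y y') \<le> 2 * ?m"
        using dist_diff_le_directed[OF S] mono(1) by (rule order_trans)
      \<comment> \<open>Exchanging the two spaces treats the opposite sign, bounded by the term for
        the converse relation.\<close>
      moreover have "ennreal (dist y y' - dist x x') \<le> 2 * ?m"
        using dist_diff_le_directed[of y x "S\<inverse>" y' x'] S mono by (auto intro: order_trans)
      ultimately show ?thesis by (simp add: abs_real_def)
    qed
    then show ?thesis unfolding distortion_def by (intro SUP_least) auto
  qed
  ultimately show ?thesis unfolding hausdorff_dist_eq_directed by (rule antisym[rotated])
qed

end
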